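(* Let $p$ be a prime, let $G$ be a finite $p$-soluble group and let $M<G$. If $|G:M|=p$, then every maximal subgroup of $M$ is a strictly $2$-maximal subgroup of $G$. In particular, in a finite soluble group $G$, if $M$ is a subgroup of prime index in $G$, then all maximal subgroups of $M$ are strictly $2$-maximal subgroups of $G$.
   Context: All groups are finite. A subgroup $M$ of a group $G$ is maximal, written $M\lessdot G$, if $M<G$ (proper) and $M\le H\le G$ implies $H=M$ or $H=G$. For a subgroup $H\le G$, $\mathrm{Max}(G,H)=\{M\lessdot G\mid H\le M\}$ is the set of maximal subgroups of $G$ containing $H$. A proper subgroup $H$ of $G$ is called strictly $2$-maximal in $G$ if $H\lessdot M$ for all $M\in \mathrm{Max}(G,H)$. A finite group is $p$-soluble if each of its chief factors is either a $p$-group or has order not divisible by $p$. *)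

theory Defs
  imports "HOL-Algebra.Algebra" "HOL-Computational_Algebra.Primes"
begin

definition maximal_subgroup :: "'a set \<Rightarrow> ('a, 'b) monoid_scheme \<Rightarrow> bool" where
  "maximal_subgroup M G \<longleftrightarrow> subgroup M G \<and> M \<noteq> carrier G \<and>
     (\<forall>H. subgroup H G \<and> M \<subseteq> H \<longrightarrow> H = M \<or> H = carrier G)"

definition Max_containing :: "('a, 'b) monoid_scheme \<Rightarrow> 'a set \<Rightarrow> 'a set set" where
  "Max_containing G H = {M. maximal_subgroup M G \<and> H \<subseteq> M}"

definition strictly_2_maximal :: "'a set \<Rightarrow> ('a, 'b) monoid_scheme \<Rightarrow> bool" where
  "strictly_2_maximal H G \<longleftrightarrow> subgroup H G \<and> H \<noteq> carrier G \<and>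
     (\<forall>M \<in> Max_containing G H. maximal_subgroup H (G\<lparr>carrier := M\<rparr>))"

text \<open>The pair \<open>K\<close>, \<open>L\<close> stands for the chief factor \<open>K/L\<close>: by the correspondence theorem, the
  second line says that \<open>K/L\<close> is a minimal normal subgroup of \<open>G/L\<close>.\<close>

definition chief_factor :: "('a, 'b) monoid_scheme \<Rightarrow> 'a set \<Rightarrow> 'a set \<Rightarrow> bool" where
  "chief_factor G K L \<longleftrightarrow> K \<lhd> G \<and> L \<lhd> G \<and> L \<subset> K \<and>
     (\<forall>N. N \<lhd> G \<and> L \<subseteq> N \<and> N \<subseteq> K \<longrightarrow> N = L \<or> N = K)"

text \<open>The next two notions are meant for finite groups only (\<^const>\<open>order\<close> is \<open>0\<close> on an
  infinite carrier).\<close>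

definition finite_p_group :: "nat \<Rightarrow> ('a, 'b) monoid_scheme \<Rightarrow> bool" where
  "finite_p_group p G \<longleftrightarrow> group G \<and> (\<exists>n. order G = p ^ n)"

definition p_soluble :: "nat \<Rightarrow> ('a, 'b) monoid_scheme \<Rightarrow> bool" where
  "p_soluble p G \<longleftrightarrow> (\<forall>K L. chief_factor G K L \<longrightarrow>
     finite_p_group p (G\<lparr>carrier := K\<rparr> Mod L) \<or> \<not> p dvd order (G\<lparr>carrier := K\<rparr> Mod L))"

end

theory Submission
  imports Defs
begin

text \<open>
  Let \<open>|G : M| = p\<close>, let \<open>H\<close> be maximal in \<open>M\<close>, and let \<open>K \<noteq> M\<close> be another maximal subgroup of \<open>G\<close>
  containing \<open>H\<close>. As \<open>M\<close> is maximal in \<open>G\<close>, maximality of \<open>H\<close> in \<open>M\<close> forces \<open>H = K \<inter> M\<close>. If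
  \<open>KM = G\<close>, then \<open>|K : H| = |G : M| = p\<close> is prime and \<open>H\<close> is maximal in \<open>K\<close>. The only difficulty is
  therefore \<open>KM \<noteq> G\<close>, where \<open>|K : H| < p\<close> need not be prime a priori.

  Solubility enters through a single consequence: there is a normal subgroup \<open>N\<close> of \<open>G\<close>, not
  contained in \<open>M\<close>, such that \<open>A = N \<inter> M\<close> is normal in \<open>N\<close>. Then \<open>M\<close> normalises \<open>A\<close> as well, so \<open>A\<close>
  is normal in \<open>NM = G\<close>, and \<open>N/A\<close> has order \<open>p\<close>. When \<open>KM \<noteq> G\<close>, the subgroup \<open>K\<close> does not
  contain \<open>N\<close>, since \<open>NM = G\<close>, but it contains \<open>A\<close>, since otherwise \<open>KM \<supseteq> KA = G\<close>; hence
  \<open>N \<inter> K = A = N \<inter> M\<close>. So \<open>K\<close> and \<open>M\<close> are both complements of \<open>N\<close> modulo \<open>A\<close>, and \<open>L \<mapsto> NL \<inter> M\<close>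
  maps the subgroups between \<open>H\<close> and \<open>K\<close> injectively to subgroups between \<open>H\<close> and \<open>M\<close>. As \<open>H\<close> is
  maximal in \<open>M\<close>, it is maximal in \<open>K\<close>. This is \<open>strictly_2_maximal_if_normal_Int\<close>.

  For soluble \<open>G\<close>, the last term of the derived series that is not contained in \<open>M\<close> serves as \<open>N\<close>:
  its derived subgroup lies in \<open>N \<inter> M\<close>. For \<open>p\<close>-soluble \<open>G\<close>, take \<open>N\<close> of least order among the normal
  subgroups not contained in \<open>M\<close>, and \<open>E\<close> of largest order among the normal subgroups of \<open>G\<close> inside
  \<open>N \<inter> M\<close>. Then \<open>N/E\<close> is a chief factor whose order is divisible by \<open>|N : N \<inter> M| = p\<close>, hence a
  \<open>p\<close>-group, and a subgroup of index \<open>p\<close> in a \<open>p\<close>-group is normal.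
\<close>

section \<open>Subgroup orders and maximality\<close>

context group
begin

lemma maximal_subgroup_subgroup_iff:
  assumes "subgroup M G"
  shows "maximal_subgroup H (G\<lparr>carrier := M\<rparr>) \<longleftrightarrow>
    subgroup H G \<and> H \<subset> M \<and> (\<forall>L. subgroup L G \<and> H \<subseteq> L \<and> L \<subseteq> M \<longrightarrow> L = H \<or> L = M)"
proof -
  have iff: "subgroup L (G\<lparr>carrier := M\<rparr>) \<longleftrightarrow> subgroup L G \<and> L \<subseteq> M" for L
    using incl_subgroup[OF assms] subgroup_incl[OF _ assms] subgroup.subset by fastforce
  show ?thesis
    unfolding maximal_subgroup_def iff by auto
qed

lemma card_subgroup_dvd:
  assumes "subgroup H G" "subgroup K G" "H \<subseteq> K"
  shows "card H dvd card K"
proof -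
  interpret K: group "G\<lparr>carrier := K\<rparr>"
    using assms(2) by (rule subgroup_imp_group)
  show ?thesis
    using K.lagrange[OF subgroup_incl[OF assms(1,2,3)]] dvd_triv_right[of "card H"]
    by (metis order_def[of "G\<lparr>carrier := K\<rparr>", simplified])
qed

lemma card_subgroup_pos:
  assumes "finite (carrier G)" "subgroup H G"
  shows "card H > 0"
  using finite_subset[OF subgroup.subset[OF assms(2)] assms(1)] subgroup.one_closed[OF assms(2)]
  by (auto simp: card_gt_0_iff)

lemma prime_index_imp_maximal_subgroup:
  assumes fin: "finite (carrier G)" and H: "subgroup H G" and p: "Factorial_Ring.prime p"
    and card: "order G = p * card H"
  shows "maximal_subgroup H G"
  unfolding maximal_subgroup_def
proof (intro conjI allI impI)
  have pos: "card H > 0"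
    using fin H by (rule card_subgroup_pos)
  show "subgroup H G" by fact
  show "H \<noteq> carrier G"
    using card pos p prime_gt_1_nat[OF p] by (auto simp: order_def)
  fix L
  assume "subgroup L G \<and> H \<subseteq> L"
  then have L: "subgroup L G" "H \<subseteq> L" by auto
  have finL: "finite L" using finite_subset[OF subgroup.subset[OF L(1)] fin] .
  obtain a where a: "card L = card H * a"
    using card_subgroup_dvd[OF H L] by blast
  have "card L dvd order G"
    unfolding order_def using card_subgroup_dvd[OF L(1) subgroup_self subgroup.subset[OF L(1)]] .
  then have "a dvd p"
    using pos unfolding card a by (simp add: mult.commute)
  then have "a = 1 \<or> a = p"
    using p by (simp add: prime_nat_iff)
  then show "L = H \<or> L = carrier G"
  proof
    assume "a = 1"
    then show ?thesis using card_subset_eq[OF finL L(2)] a by simp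
  next
    assume "a = p"
    then show ?thesis
      using card_subset_eq[OF fin subgroup.subset[OF L(1)]] a card
      by (simp add: order_def mult.commute)
  qed
qed

text \<open>The product formula: every fibre of the multiplication map \<open>A \<times> C \<rightarrow> AC\<close> is a translate of the
  set of pairs \<open>(d, d\<inverse>)\<close> with \<open>d \<in> A \<inter> C\<close>.\<close>

lemma card_set_mult_subgroups:
  assumes fin: "finite (carrier G)" and A: "subgroup A G" and C: "subgroup C G"
  shows "card (A <#> C) * card (A \<inter> C) = card A * card C"
proof -
  let ?f = "\<lambda>(a, c). a \<otimes> c"
  let ?fib = "\<lambda>x. {y \<in> A \<times> C. ?f y = x}"
  note mem = subgroup.mem_carrier[OF A] subgroup.mem_carrier[OF C]
  have finA: "finite A" and finC: "finite C"
    by (rule finite_subset[OF subgroup.subset[OF A] fin], rule finite_subset[OF subgroup.subset[OF C] fin])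
  have img: "?f ` (A \<times> C) = A <#> C"
    by (auto simp: set_mult_def image_iff)
  have fib: "card (?fib x) = card (A \<inter> C)" if x: "x \<in> A <#> C" for x
  proof -
    obtain a c where ac: "a \<in> A" "c \<in> C" "x = a \<otimes> c"
      using x by (auto simp: set_mult_def)
    let ?g = "\<lambda>d. (a \<otimes> d, inv d \<otimes> c)"
    have "?fib x = ?g ` (A \<inter> C)"
    proof (intro equalityI subsetI)
      fix y assume "y \<in> ?fib x"
      then obtain a' c' where y: "y = (a', c')" "a' \<in> A" "c' \<in> C" "a' \<otimes> c' = a \<otimes> c"
        using ac by auto
      define d where "d = inv a \<otimes> a'"
      have d: "d = c \<otimes> inv c'"
        unfolding d_def using y ac mem by (metis inv_closed inv_solve_left inv_solve_right m_assoc m_closed)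
      have "d \<in> A"
        unfolding d_def using A ac y by (simp add: subgroup.m_closed subgroup.m_inv_closed)
      moreover have "d \<in> C"
        unfolding d using C ac y by (simp add: subgroup.m_closed subgroup.m_inv_closed)
      moreover have "a' = a \<otimes> d"
        unfolding d_def using y ac mem by (simp add: m_assoc[symmetric])
      moreover have "c' = inv d \<otimes> c"
        unfolding d using y ac mem by (simp add: inv_mult_group m_assoc)
      ultimately show "y \<in> ?g ` (A \<inter> C)"
        using y by auto
    next
      fix y assume "y \<in> ?g ` (A \<inter> C)"
      then obtain d where d: "d \<in> A" "d \<in> C" "y = ?g d" by auto
      have "a \<otimes> d \<otimes> (inv d \<otimes> c) = a \<otimes> c"
        using d ac mem by (metis inv_closed inv_solve_left m_assoc m_closed)
      then show "y \<in> ?fib x"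
        using d ac A C by (auto simp: subgroup.m_closed subgroup.m_inv_closed)
    qed
    moreover have "inj_on ?g (A \<inter> C)"
      using ac mem by (auto intro!: inj_onI)
    ultimately show ?thesis
      by (simp add: card_image)
  qed
  have "card A * card C = card (A \<times> C)"
    by (simp add: card_cartesian_product)
  also have "\<dots> = (\<Sum>x \<in> ?f ` (A \<times> C). \<Sum>y \<in> ?fib x. 1)"
    using sum.image_gen[of "A \<times> C" "\<lambda>_. 1::nat" ?f] finA finC by simp
  also have "\<dots> = (\<Sum>x \<in> A <#> C. card (A \<inter> C))"
    unfolding img using fib by (intro sum.cong) auto
  finally show ?thesis by simp
qed

section \<open>Supplements of a subgroup of prime index\<close>

lemma maximal_subgroup_normal_supplement:
  assumes M: "maximal_subgroup M G" and N: "N \<lhd> G" "\<not> N \<subseteq> M"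
  shows "N <#> M = carrier G"
proof -
  have M': "subgroup M G"
    using M by (simp add: maximal_subgroup_def)
  have sub: "subgroup (N <#> M) G"
    using mult_norm_subgroup[OF N(1) M'] .
  have "M \<subseteq> N <#> M"
    using subgroup_of_normal_set_mult[OF N(1) M'] subgroup.subset by fastforce
  moreover have "N \<subseteq> N <#> M"
    using subgroup.one_closed[OF M'] normal_imp_subgroup[OF N(1)]
    by (force simp: set_mult_def dest: subgroup.mem_carrier)
  ultimately show ?thesis
    using M N(2) sub unfolding maximal_subgroup_def by blast
qed

lemma card_supplement:
  assumes fin: "finite (carrier G)"
    and M: "subgroup M G" "order G = p * card M"
    and K: "subgroup K G" "K <#> M = carrier G"
  shows "card K = p * card (K \<inter> M)"
proof -
  have "card K * card M = order G * card (K \<inter> M)"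
    using card_set_mult_subgroups[OF fin K(1) M(1)] K(2) by (simp add: order_def)
  also have "\<dots> = p * card (K \<inter> M) * card M"
    unfolding M(2) by simp
  finally show ?thesis
    using card_subgroup_pos[OF fin M(1)] by simp
qed

text \<open>Passing to a supplement \<open>K\<close> of \<open>M\<close> keeps the index: \<open>|K : K \<inter> M| = |G : M| = p\<close>, and a
  subgroup of prime index is maximal.\<close>

lemma maximal_subgroup_Int_supplement:
  assumes fin: "finite (carrier G)" and p: "Factorial_Ring.prime p"
    and M: "subgroup M G" "order G = p * card M"
    and K: "subgroup K G" "K <#> M = carrier G"
  shows "maximal_subgroup (K \<inter> M) (G\<lparr>carrier := K\<rparr>)"
proof -
  interpret K: group "G\<lparr>carrier := K\<rparr>"
    using K(1) by (rule subgroup_imp_group)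
  have "card K = p * card (K \<inter> M)"
    using fin M K by (rule card_supplement)
  moreover have "finite K"
    using finite_subset[OF subgroup.subset[OF K(1)] fin] .
  ultimately show ?thesis
    using p K M by (intro K.prime_index_imp_maximal_subgroup[of _ p])
      (auto simp: order_def intro: subgroup_incl subgroups_Inter_pair)
qed

text \<open>\<open>M\<close> normalises \<open>N \<inter> M\<close> because \<open>N\<close> is normal, and \<open>N\<close> does so by hypothesis; together they
  generate \<open>G\<close>.\<close>

lemma normal_Int_if_normal_in_factor:
  assumes N: "N \<lhd> G" and M: "subgroup M G" and G: "N <#> M = carrier G"
    and A: "N \<inter> M \<lhd> G\<lparr>carrier := N\<rparr>"
  shows "N \<inter> M \<lhd> G"
proof (rule normal_invI)
  have N': "subgroup N G" using N by (rule normal_imp_subgroup)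
  show "subgroup (N \<inter> M) G"
    using N' M by (rule subgroups_Inter_pair)
  fix x h assume "x \<in> carrier G" and h: "h \<in> N \<inter> M"
  then obtain n m where x: "n \<in> N" "m \<in> M" "x = n \<otimes> m"
    unfolding G[symmetric] set_mult_def by blast
  note mem = subgroup.mem_carrier[OF N'] subgroup.mem_carrier[OF M]
  have "m \<otimes> h \<otimes> inv m \<in> N \<inter> M"
    using h x mem M normal_invE(2)[OF N] by (auto simp: subgroup.m_closed subgroup.m_inv_closed)
  then have "n \<otimes> (m \<otimes> h \<otimes> inv m) \<otimes> inv n \<in> N \<inter> M"
    using group.normal_invE(2)[OF subgroup_imp_group[OF N'] A, of n] x m_inv_consistent[OF N']
    by simp
  moreover have "n \<otimes> (m \<otimes> h \<otimes> inv m) \<otimes> inv n = x \<otimes> h \<otimes> inv x"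
    using x h mem by (simp add: inv_mult_group m_assoc)
  ultimately show "x \<otimes> h \<otimes> inv x \<in> N \<inter> M" by simp
qed

section \<open>Maximality of the common subgroup\<close>

text \<open>A modular-law argument, in which \<open>N \<inter> K \<subseteq> M\<close> says that \<open>K\<close> complements \<open>N\<close> up to
  \<open>K \<inter> M\<close>. For \<open>L\<close> between \<open>K \<inter> M\<close> and \<open>K\<close>, the group \<open>NL \<inter> M\<close> lies between \<open>K \<inter> M\<close> and \<open>M\<close>, so it is one of the two ends.
  Writing elements as products with a factor in \<open>N\<close>, and observing that this factor falls into
  \<open>N \<inter> K \<subseteq> K \<inter> M \<subseteq> L\<close>, shows that \<open>L\<close> is the corresponding end of its interval.\<close>

lemma maximal_subgroup_Int_normal_complement:
  assumes M: "subgroup M G" and K: "subgroup K G" and N: "N \<lhd> G" "N <#> M = carrier G"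
    and H: "maximal_subgroup (K \<inter> M) (G\<lparr>carrier := M\<rparr>)" "K \<inter> M \<noteq> K"
    and NK: "N \<inter> K \<subseteq> M"
  shows "maximal_subgroup (K \<inter> M) (G\<lparr>carrier := K\<rparr>)"
  unfolding maximal_subgroup_subgroup_iff[OF K]
proof (intro conjI allI impI)
  show "subgroup (K \<inter> M) G" using K M by (rule subgroups_Inter_pair)
  show "K \<inter> M \<subset> K" using H(2) by auto
  fix L assume L: "subgroup L G \<and> K \<inter> M \<subseteq> L \<and> L \<subseteq> K"
  have N': "subgroup N G" using N(1) by (rule normal_imp_subgroup)
  note mem = subgroup.mem_carrier[OF N'] subgroup.mem_carrier[OF M] subgroup.mem_carrier[OF K]
  have NL: "subgroup (N <#> L) G"
    using mult_norm_subgroup[OF N(1)] L by blast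
  have "L \<subseteq> N <#> L"
    using subgroup_of_normal_set_mult[OF N(1)] L subgroup.subset by fastforce
  then have "K \<inter> M \<subseteq> (N <#> L) \<inter> M" using L by auto
  then consider "(N <#> L) \<inter> M = K \<inter> M" | "(N <#> L) \<inter> M = M"
    using H(1) subgroups_Inter_pair[OF NL M] unfolding maximal_subgroup_subgroup_iff[OF M] by blast
  then show "L = K \<inter> M \<or> L = K"
  proof cases
    case 1
    have "L \<subseteq> M"
    proof
      fix l assume l: "l \<in> L"
      then have lc: "l \<in> carrier G" "l \<in> K" using L mem by auto
      obtain n m where nm: "n \<in> N" "m \<in> M" "l = n \<otimes> m"
        using lc(1) unfolding N(2)[symmetric] set_mult_def by blast
      have m: "m = inv n \<otimes> l" 
        using nm mem by (simp add: m_assoc[symmetric])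
      then have "m \<in> N <#> L"
        using l nm N' by (auto simp: set_mult_def intro: subgroup.m_inv_closed)
      then have mK: "m \<in> K" using 1 nm by auto
      have "n = l \<otimes> inv m" using nm mem by (simp add: m_assoc)
      then have "n \<in> K" using mK lc K by (simp add: subgroup.m_closed subgroup.m_inv_closed)
      then have "n \<in> M" using nm NK by auto
      then show "l \<in> M" using nm M by (simp add: subgroup.m_closed)
    qed
    then show ?thesis using L by blast
  next
    case 2
    have "K \<subseteq> L"
    proof
      fix k assume k: "k \<in> K"
      then have "k \<in> N <#> M" using N(2) mem by auto
      then obtain n m where nm: "n \<in> N" "m \<in> M" "k = n \<otimes> m"
        by (auto simp: set_mult_def)
      have "m \<in> N <#> L" using 2 nm by auto
      then obtain n' l where nl: "n' \<in> N" "l \<in> L" "m = n' \<otimes> l"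
        by (auto simp: set_mult_def)
      have lK: "l \<in> K" using nl L by auto
      have "n \<otimes> n' = k \<otimes> inv l"
        using nm nl lK mem by (simp add: m_assoc)
      then have "n \<otimes> n' \<in> N \<inter> K" 
        using k lK K nm nl N' by (metis IntI subgroup.m_closed subgroup.m_inv_closed)
      then have "n \<otimes> n' \<in> L" using NK L by auto
      moreover have "k = n \<otimes> n' \<otimes> l" using nm nl lK mem by (simp add: m_assoc)
      ultimately show "k \<in> L" using L nl by (simp add: subgroup.m_closed)
    qed
    then show ?thesis using L by auto
  qed
qed

text \<open>Both the soluble and the \<open>p\<close>-soluble case reduce to this criterion. Let \<open>K\<close> be a maximal subgroup
  containing \<open>H\<close> with \<open>KM \<noteq> G\<close>. Then \<open>K\<close> does not contain \<open>N\<close>, because \<open>NM = G\<close>, but it contains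
  \<open>N \<inter> M\<close>, because otherwise this normal subgroup would supplement \<open>K\<close> from within \<open>M\<close>. As
  \<open>N \<inter> M\<close> is maximal in \<open>N\<close>, this yields \<open>N \<inter> K = N \<inter> M\<close>.\<close>

theorem strictly_2_maximal_if_normal_Int:
  assumes fin: "finite (carrier G)" and p: "Factorial_Ring.prime p"
    and M: "subgroup M G" "order G = p * card M"
    and N: "N \<lhd> G" "\<not> N \<subseteq> M" "N \<inter> M \<lhd> G\<lparr>carrier := N\<rparr>"
    and H: "maximal_subgroup H (G\<lparr>carrier := M\<rparr>)"
  shows "strictly_2_maximal H G"
proof -
  have maxM: "maximal_subgroup M G"
    using fin M(1) p M(2) by (rule prime_index_imp_maximal_subgroup)
  have N': "subgroup N G" using N(1) by (rule normal_imp_subgroup)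
  have NM: "N <#> M = carrier G"
    using maxM N(1,2) by (rule maximal_subgroup_normal_supplement)
  have A: "N \<inter> M \<lhd> G"
    using N(1) M(1) NM N(3) by (rule normal_Int_if_normal_in_factor)
  have H': "subgroup H G" "H \<subset> M"
    and Hmax: "\<And>L. subgroup L G \<Longrightarrow> H \<subseteq> L \<Longrightarrow> L \<subseteq> M \<Longrightarrow> L = H \<or> L = M"
    using H unfolding maximal_subgroup_subgroup_iff[OF M(1)] by auto
  have "maximal_subgroup H (G\<lparr>carrier := K\<rparr>)" if "K \<in> Max_containing G H" for K
  proof (cases "K = M")
    case True
    then show ?thesis using H by simp
  next
    case False
    have K: "maximal_subgroup K G" "H \<subseteq> K" "subgroup K G"
      using that by (auto simp: Max_containing_def maximal_subgroup_def)
    have "\<not> M \<subseteq> K" "\<not> K \<subseteq> M"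
      using K maxM False unfolding maximal_subgroup_def by blast+
    then have HKM: "H = K \<inter> M"
      using Hmax[OF subgroups_Inter_pair[OF K(3) M(1)]] H' K(2) by blast
    show ?thesis
    proof (cases "K <#> M = carrier G")
      case True
      then show ?thesis
        unfolding HKM using maximal_subgroup_Int_supplement[OF fin p M K(3)] by simp
    next
      case noG: False
      have AK: "N \<inter> M \<subseteq> K"
      proof (rule ccontr)
        assume "\<not> N \<inter> M \<subseteq> K"
        then have "(N \<inter> M) <#> K = carrier G"
          using K(1) A by (intro maximal_subgroup_normal_supplement)
        then have "K <#> (N \<inter> M) = carrier G"
          using commut_normal[OF K(3) A] by simp
        then have "carrier G \<subseteq> K <#> M"
          by (metis mono_set_mult order_refl inf_le2)
        then show False
          using noG K(3) M(1) by (meson equalityI setmult_subset_G subgroup.subset)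
      qed
      have "\<not> N \<subseteq> K"
        using NM noG mono_set_mult[of N K M M G] K(3) M(1)
        by (metis equalityI order_refl setmult_subset_G subgroup.subset)
      have "N \<inter> K = N \<inter> M"
      proof -
        have "maximal_subgroup (N \<inter> M) (G\<lparr>carrier := N\<rparr>)"
          using maximal_subgroup_Int_supplement[OF fin p M N' NM] .
        then show ?thesis
          using AK \<open>\<not> N \<subseteq> K\<close> subgroups_Inter_pair[OF N' K(3)]
          unfolding maximal_subgroup_subgroup_iff[OF N'] by blast
      qed
      then show ?thesis
        unfolding HKM using maximal_subgroup_Int_normal_complement[OF M(1) K(3) N(1) NM] H HKM
          \<open>\<not> K \<subseteq> M\<close> by auto
    qed
  qed
  then show ?thesis
    using H' subgroup.subset[OF M(1)] by (auto simp: strictly_2_maximal_def)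
qed

section \<open>Subgroups of index p in a p-group\<close>

text \<open>Modulo \<open>E\<close> this says that a subgroup of index \<open>p\<close> in a \<open>p\<close>-group is normal. Let \<open>C\<close> be a
  conjugate of \<open>A\<close> by an element outside \<open>A\<close>. Then \<open>AC \<noteq> G\<close>, because a group is never the product of
  a proper subgroup with one of its conjugates, so the product formula gives \<open>|A : A \<inter> C| < p\<close>.
  As \<open>E \<subseteq> A \<inter> C\<close>, this index is also a power of \<open>p\<close>, hence \<open>1\<close>.\<close>

lemma normal_if_prime_index_above_p_quotient:
  assumes fin: "finite (carrier G)" and p: "Factorial_Ring.prime p"
    and A: "subgroup A G" "order G = p * card A"
    and E: "E \<lhd> G" "E \<subseteq> A" "card (rcosets E) = p ^ n"
  shows "A \<lhd> G"
proof (rule normal_invI)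
  show "subgroup A G" by fact
  fix g h assume g: "g \<in> carrier G" and h: "h \<in> A"
  show "g \<otimes> h \<otimes> inv g \<in> A"
  proof (cases "g \<in> A")
    case True
    then show ?thesis using A(1) h by (simp add: subgroup.m_closed subgroup.m_inv_closed)
  next
    case False
    define C where "C = (\<lambda>a. g \<otimes> a \<otimes> inv g) ` A"
    note mem = subgroup.mem_carrier[OF A(1)]
    have finA: "finite A" using finite_subset[OF subgroup.subset[OF A(1)] fin] .
    have E': "subgroup E G" using E(1) by (rule normal_imp_subgroup)
    have C: "subgroup C G"
    proof (rule subgroupI)
      show "C \<subseteq> carrier G" using g mem by (auto simp: C_def)
      show "C \<noteq> {}" using subgroup.one_closed[OF A(1)] by (auto simp: C_def)
    next
      fix a assume "a \<in> C"
      then obtain x where x: "x \<in> A" "a = g \<otimes> x \<otimes> inv g" by (auto simp: C_def)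
      then have "inv a = g \<otimes> inv x \<otimes> inv g" using g mem by (simp add: inv_mult_group m_assoc)
      then show "inv a \<in> C" using x A(1) by (auto simp: C_def subgroup.m_inv_closed)
    next
      fix a b assume "a \<in> C" "b \<in> C"
      then obtain x y where x: "x \<in> A" "a = g \<otimes> x \<otimes> inv g" and y: "y \<in> A" "b = g \<otimes> y \<otimes> inv g"
        by (auto simp: C_def)
      have "a \<otimes> b = g \<otimes> (x \<otimes> y) \<otimes> inv g"
        using g x y mem by (simp add: m_assoc inv_solve_left)
          (metis inv_closed inv_solve_left m_assoc m_closed)
      then show "a \<otimes> b \<in> C" using x y A(1) by (auto simp: C_def subgroup.m_closed)
    qed
    have cardC: "card C = card A"
      unfolding C_def using g mem by (intro card_image inj_onI) auto
    have B: "subgroup (A \<inter> C) G" using A(1) C by (rule subgroups_Inter_pair)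
    have "E \<subseteq> C"
    proof
      fix e assume e: "e \<in> E"
      then have "inv g \<otimes> e \<otimes> g \<in> A"
        using normal.inv_op_closed1[OF E(1) g e] E(2) by auto
      moreover have "e = g \<otimes> (inv g \<otimes> e \<otimes> g) \<otimes> inv g"
        using g e subgroup.mem_carrier[OF E'] by (simp add: m_assoc inv_solve_left')
          (metis inv_closed inv_solve_left m_assoc m_closed r_inv r_one)
      ultimately show "e \<in> C" unfolding C_def by blast
    qed
    then have EB: "E \<subseteq> A \<inter> C" using E(2) by auto
    obtain j where j: "card A = card (A \<inter> C) * j"
      using card_subgroup_dvd[OF B A(1)] by blast
    have jp: "j dvd p ^ n"
    proof -
      obtain l where l: "card (A \<inter> C) = card E * l"
        using card_subgroup_dvd[OF E' B EB] by blast
      have "p ^ n * card E = p * (card E * l * j)"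
        using lagrange[OF E'] A(2) E(3) j l by simp
      then have "p ^ n = p * l * j"
        using card_subgroup_pos[OF fin E'] by (simp add: mult_ac)
      then show ?thesis by simp
    qed
    \<comment> \<open>The inverse is the convenient witness for \<open>AC \<noteq> G\<close>: in \<open>g\<inverse> = a(gxg\<inverse>)\<close> the factors \<open>g\<inverse>\<close>
      cancel, which leaves \<open>g = a\<inverse>x\<inverse> \<in> A\<close>.\<close>
    have "inv g \<notin> A <#> C"
    proof
      assume "inv g \<in> A <#> C"
      then obtain a x where x: "a \<in> A" "x \<in> A" "inv g = a \<otimes> (g \<otimes> x \<otimes> inv g)"
        by (auto simp: set_mult_def C_def)
      then have "inv g = (a \<otimes> g \<otimes> x) \<otimes> inv g" using g mem by (simp add: m_assoc)
      then have "\<one> = a \<otimes> g \<otimes> x" using g x mem by (metis inv_closed l_one m_closed one_closed right_cancel)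
      then have "g = inv a \<otimes> inv x" 
        using g x mem by (metis inv_closed inv_equality inv_inv inv_mult_group inv_solve_left m_assoc m_closed r_one)
      then show False using False x A(1) by (simp add: subgroup.m_closed subgroup.m_inv_closed)
    qed
    then have "A <#> C \<subset> carrier G"
      using g setmult_subset_G[OF subgroup.subset[OF A(1)] subgroup.subset[OF C]] by auto
    then have "card (A <#> C) < p * card A"
      using psubset_card_mono[OF fin] A(2) by (simp add: order_def)
    then have "card (A <#> C) * card (A \<inter> C) < p * card A * card (A \<inter> C)"
      using card_subgroup_pos[OF fin B] by simp
    then have "card A * card A < p * card A * card (A \<inter> C)"
      using card_set_mult_subgroups[OF fin A(1) C] cardC by simp
    then have "card (A \<inter> C) * j < card (A \<inter> C) * p"
      using j by (simp add: mult_ac)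
    then have "j < p" by simp
    moreover obtain i where "j = p ^ i" using jp p by (auto simp: divides_primepow_nat)
    ultimately have "j = 1"
      using prime_gt_1_nat[OF p] by (metis gr0I not_less power_0 self_le_power less_imp_le)
    then have "A \<inter> C = A" using j finA by (simp add: card_subset_eq)
    then have "C = A" using finA cardC by (metis card_subset_eq finite_imageI C_def inf.absorb_iff1)
    then show ?thesis using h by (auto simp: C_def)
  qed
qed

section \<open>Normal subgroups supplied by solubility\<close>

text \<open>The minimal choice of \<open>N\<close> and the maximal choice of \<open>E\<close> make \<open>N/E\<close> a chief factor: a normal
  subgroup of \<open>G\<close> between them is either contained in \<open>M\<close>, and then no larger than \<open>E\<close>, or not, and
  then no smaller than \<open>N\<close>. Since \<open>p\<close> divides \<open>|N : E|\<close>, the alternative of a \<open>p'\<close>-factor is excluded.\<close>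

lemma p_soluble_imp_normal_Int:
  assumes fin: "finite (carrier G)" and p: "Factorial_Ring.prime p" and sol: "p_soluble p G"
    and M: "subgroup M G" "order G = p * card M"
  shows "\<exists>N. N \<lhd> G \<and> \<not> N \<subseteq> M \<and> N \<inter> M \<lhd> G\<lparr>carrier := N\<rparr>"
proof -
  have maxM: "maximal_subgroup M G"
    using fin M(1) p M(2) by (rule prime_index_imp_maximal_subgroup)
  have finsub: "finite R" if "R \<lhd> G" for R
    using finite_subset[OF subgroup.subset[OF normal_imp_subgroup[OF that]] fin] .
  have "\<exists>N. N \<lhd> G \<and> \<not> N \<subseteq> M"
    using normal_self maxM M(1) subgroup.subset unfolding maximal_subgroup_def by blast
  then obtain N where N: "N \<lhd> G" "\<not> N \<subseteq> M"
    and Nmin: "\<And>R. R \<lhd> G \<Longrightarrow> \<not> R \<subseteq> M \<Longrightarrow> card N \<le> card R"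
    using ex_has_least_nat[of "\<lambda>N. N \<lhd> G \<and> \<not> N \<subseteq> M" _ card] by blast
  have N': "subgroup N G" using N(1) by (rule normal_imp_subgroup)
  have "\<exists>E. (E \<lhd> G \<and> E \<subseteq> N \<inter> M) \<and> (\<forall>R. R \<lhd> G \<and> R \<subseteq> N \<inter> M \<longrightarrow> card R \<le> card E)"
  proof (rule ex_has_greatest_nat[where b = "Suc (card N)"])
    show "{\<one>} \<lhd> G \<and> {\<one>} \<subseteq> N \<inter> M"
      using one_is_normal subgroup.one_closed[OF N'] subgroup.one_closed[OF M(1)] by auto
    show "\<forall>R. R \<lhd> G \<and> R \<subseteq> N \<inter> M \<longrightarrow> card R < Suc (card N)"
      using card_mono[OF finsub[OF N(1)]] by (simp add: less_Suc_eq_le)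
  qed
  then obtain E where E: "E \<lhd> G" "E \<subseteq> N \<inter> M"
    and Emax: "\<And>R. R \<lhd> G \<Longrightarrow> R \<subseteq> N \<inter> M \<Longrightarrow> card R \<le> card E"
    by blast
  have E': "subgroup E G" using E(1) by (rule normal_imp_subgroup)
  have chief: "chief_factor G N E"
    unfolding chief_factor_def
  proof (intro conjI allI impI)
    show "N \<lhd> G" "E \<lhd> G" "E \<subset> N" using N E by auto
    fix R assume R: "R \<lhd> G \<and> E \<subseteq> R \<and> R \<subseteq> N"
    show "R = E \<or> R = N"
    proof (cases "R \<subseteq> M")
      case True
      then show ?thesis using Emax[of R] R finsub[of R] card_seteq[of R E] by auto
    next
      case False
      then show ?thesis using Nmin[of R] R finsub[OF N(1)] card_seteq[of N R] by auto
    qed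
  qed
  interpret GN: group "G\<lparr>carrier := N\<rparr>" using N' by (rule subgroup_imp_group)
  have NM: "N <#> M = carrier G"
    using maxM N by (rule maximal_subgroup_normal_supplement)
  have A: "subgroup (N \<inter> M) G" using N' M(1) by (rule subgroups_Inter_pair)
  have cardN: "card N = p * card (N \<inter> M)"
    using fin M N' NM by (rule card_supplement)
  have EN: "E \<lhd> G\<lparr>carrier := N\<rparr>"
    using normal_restrict_supergroup[OF N' E(1)] E(2) by blast
  let ?i = "card (rcosets\<^bsub>G\<lparr>carrier := N\<rparr>\<^esub> E)"
  have ord: "order (G\<lparr>carrier := N\<rparr> Mod E) = ?i"
    by (simp add: order_def FactGroup_def)
  have lag: "?i * card E = card N"
    using GN.lagrange[OF normal_imp_subgroup[OF EN]] by (simp add: order_def)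
  obtain a where a: "card (N \<inter> M) = card E * a"
    using card_subgroup_dvd[OF E' A E(2)] by blast
  have "?i * card E = (p * a) * card E"
    unfolding lag cardN a by simp
  then have "?i = p * a"
    using card_subgroup_pos[OF fin E'] by (metis mult_cancel2 less_irrefl)
  then have "p dvd ?i" by simp
  then obtain n where n: "?i = p ^ n"
    using sol chief unfolding p_soluble_def finite_p_group_def by (metis ord)
  have "N \<inter> M \<lhd> G\<lparr>carrier := N\<rparr>"
    using fin N' p A E n cardN finsub[OF N(1)]
    by (intro GN.normal_if_prime_index_above_p_quotient[OF _ p _ _ EN])
      (auto simp: order_def intro: subgroup_incl)
  then show ?thesis using N by blast
qed

text \<open>A subgroup of \<open>N\<close> containing the derived subgroup of \<open>N\<close> is normal in \<open>N\<close>, since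
  \<open>xhx\<inverse> = [x, h]h\<close>.\<close>

lemma solvable_imp_normal_Int:
  assumes sol: "solvable G" and M: "subgroup M G" "M \<noteq> carrier G"
  shows "\<exists>N. N \<lhd> G \<and> \<not> N \<subseteq> M \<and> N \<inter> M \<lhd> G\<lparr>carrier := N\<rparr>"
proof -
  let ?D = "\<lambda>n. (derived G ^^ n) (carrier G)"
  have "\<exists>n. ?D n \<subseteq> M"
    using sol subgroup.one_closed[OF M(1)] unfolding solvable_iff_trivial_derived_seq
    by (metis empty_subsetI insert_subset)
  then obtain n where n: "?D n \<subseteq> M" and least: "\<And>m. m < n \<Longrightarrow> \<not> ?D m \<subseteq> M"
    using exists_least_iff[of "\<lambda>n. ?D n \<subseteq> M"] by blast
  have "n \<noteq> 0"
    using n M subgroup.subset by fastforce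
  then obtain m where m: "n = Suc m" using not0_implies_Suc by blast
  define N where "N = ?D m"
  have "?D k \<lhd> G" for k
    by (induct k) (auto simp: normal_self derived_is_normal)
  then have N: "N \<lhd> G" by (simp add: N_def)
  then have N': "subgroup N G" by (rule normal_imp_subgroup)
  interpret GN: group "G\<lparr>carrier := N\<rparr>" using N' by (rule subgroup_imp_group)
  have dN: "derived G N \<subseteq> M" using n by (simp add: N_def m)
  have "N \<inter> M \<lhd> G\<lparr>carrier := N\<rparr>"
  proof (rule GN.normal_invI)
    show "subgroup (N \<inter> M) (G\<lparr>carrier := N\<rparr>)"
      using N' M(1) by (intro subgroup_incl subgroups_Inter_pair) auto
    fix x h assume "x \<in> carrier (G\<lparr>carrier := N\<rparr>)" and h: "h \<in> N \<inter> M"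
    then have x: "x \<in> N" by simp
    have "x \<otimes> h \<otimes> inv x \<otimes> inv h \<in> derived G N"
      unfolding derived_def using x h by (intro generate.incl) auto
    then have "x \<otimes> h \<otimes> inv x \<otimes> inv h \<otimes> h \<in> M"
      using dN h M(1) by (meson IntD2 subgroup.m_closed subset_iff)
    then have "x \<otimes> h \<otimes> inv x \<in> M"
      using x h subgroup.mem_carrier[OF N'] by (simp add: m_assoc)
    then show "x \<otimes>\<^bsub>G\<lparr>carrier := N\<rparr>\<^esub> h \<otimes>\<^bsub>G\<lparr>carrier := N\<rparr>\<^esub> inv\<^bsub>G\<lparr>carrier := N\<rparr>\<^esub> x \<in> N \<inter> M"
      using x h N' m_inv_consistent[OF N' x] by (simp add: subgroup.m_closed subgroup.m_inv_closed)
  qed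
  then show ?thesis using N least[of m] by (auto simp: N_def m)
qed

end

section \<open>Maximal subgroups of a subgroup of prime index\<close>

theorem corollary1p3:
  fixes G (structure)
  assumes "group G" and "finite (carrier G)"
  shows "(\<forall>(p::nat) M. Factorial_Ring.prime p \<and> p_soluble p G \<and> subgroup M G \<and> M \<noteq> carrier G \<and>
            card (rcosets M) = p \<longrightarrow>
            (\<forall>H. maximal_subgroup H (G\<lparr>carrier := M\<rparr>) \<longrightarrow> strictly_2_maximal H G)) \<and>
         (solvable G \<longrightarrow>
            (\<forall>M. subgroup M G \<and> Factorial_Ring.prime (card (rcosets M)) \<longrightarrow>
            (\<forall>H. maximal_subgroup H (G\<lparr>carrier := M\<rparr>) \<longrightarrow> strictly_2_maximal H G)))"
proof -
  interpret group G by fact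
  note fin = assms(2)
  have ord: "order G = card (rcosets M) * card M" if "subgroup M G" for M
    using lagrange[OF that] by simp
  have "strictly_2_maximal H G"
    if p: "Factorial_Ring.prime (card (rcosets M))" and sol: "p_soluble (card (rcosets M)) G"
      and M: "subgroup M G" and H: "maximal_subgroup H (G\<lparr>carrier := M\<rparr>)" for M H
    using p_soluble_imp_normal_Int[OF fin p sol M ord[OF M]]
      strictly_2_maximal_if_normal_Int[OF fin p M ord[OF M] _ _ _ H] by blast
  moreover have "strictly_2_maximal H G"
    if sol: "solvable G" and p: "Factorial_Ring.prime (card (rcosets M))"
      and M: "subgroup M G" and H: "maximal_subgroup H (G\<lparr>carrier := M\<rparr>)" for M H
  proof -
    have "M \<noteq> carrier G"
      using prime_index_imp_maximal_subgroup[OF fin M p ord[OF M]] by (simp add: maximal_subgroup_def)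
    then show ?thesis
      using solvable_imp_normal_Int[OF sol M]
        strictly_2_maximal_if_normal_Int[OF fin p M ord[OF M] _ _ _ H] by blast
  qed
  ultimately show ?thesis by blast
qed

end
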